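(* Let $r$ be a positive integer. For all integers $n,m,k$ with $k\ge 2$, \[ A_{r+1}(n,m,k)=A_r(n,m+1,k-1)+(r-1)\bigl(A_r(n-1,m,k-1)-A_r(n-1,m+1,k-1)\bigr). \]
   Context: $[n]=\{1,\dots,n\}$, and a permutation of $[n]$ is a bijection $\sigma:[n]\to[n]$. For a positive integer $r$, an $r$-descent of $\sigma$ is a position $i$ with $1\le i<n$ and $\sigma(i)\ge\sigma(i+1)+r$. $A_r(n,m,k)$ denotes the number of permutations $\sigma$ of $[n]$ with exactly $m$ $r$-descents and $\sigma(n)=k$.
   Formalization: The identity is proved with two added conditions, k ≠ n+1 and r ≤ n whenever k ≤ n; without them it is false, e.g. r=1, n=3, m=0, k=4 gives 0=1, and r=3, n=2, m=0, k=2 gives 1=2. *)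

theory Defs
  imports "HOL-Combinatorics.Permutations"
begin

text \<open>
  All indices are integers, so that the index shifts \<open>n - 1\<close>, \<open>m + 1\<close>, \<open>k - 1\<close> are the
  genuine ones. A bijection of \<open>{1..n}\<close> is represented by its extension by the identity
  outside \<open>{1..n}\<close> (\<open>permutes\<close>), which makes the representation unique.
\<close>

definition r_descents :: "int \<Rightarrow> int \<Rightarrow> (int \<Rightarrow> int) \<Rightarrow> int set"
  where "r_descents r n \<sigma> = {i. 1 \<le> i \<and> i < n \<and> \<sigma> i \<ge> \<sigma> (i + 1) + r}"

text \<open>
  The conjunct \<open>1 \<le> n\<close> makes the number zero for \<open>n \<le> 0\<close>, where the last value \<open>\<sigma>(n)\<close> of a
  permutation of the empty set does not exist; otherwise the identity extension would
  count when \<open>k = n \<le> 0\<close> and \<open>m = 0\<close>.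
\<close>

definition A :: "int \<Rightarrow> int \<Rightarrow> int \<Rightarrow> int \<Rightarrow> int"
  where "A r n m k =
    int (card {\<sigma>. \<sigma> permutes {1..n} \<and> 1 \<le> n \<and>
                  int (card (r_descents r n \<sigma>)) = m \<and> \<sigma> n = k})"

end

theory Submission
  imports Defs
begin

text \<open>
  Insert the maximum \<open>n\<close> into a permutation \<open>\<tau>\<close> of \<open>{1..n - 1}\<close> in front of position \<open>p\<close>. The
  pair ending in \<open>n\<close> is no \<open>r\<close>-descent, so one \<open>r\<close>-descent is gained if \<open>\<tau> p \<le> n - r\<close> and
  \<open>p - 1\<close> was not already an \<open>r\<close>-descent, and otherwise the number is unchanged. If \<open>\<tau>\<close> has \<open>d\<close>
  \<open>r\<close>-descents, exactly \<open>n - r - d\<close> positions \<open>p < n\<close> gain one. For \<open>k < n\<close> and \<open>r \<le> n\<close> this gives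
  \<open>A r n m k = (m + r - 1) A r (n - 1) m k + (n - r - m + 1) A r (n - 1) (m - 1) k\<close>, and a similar
  recurrence for the number of all permutations with \<open>m\<close> \<open>r\<close>-descents, which governs the case
  \<open>k = n\<close>. Both sides of the claim satisfy the same recurrence in \<open>n\<close>, and for \<open>n = r\<close> no
  permutation has \<open>r\<close>-descents.
\<close>

section \<open>Insertion of the maximum into a permutation\<close>

definition insert_max :: "int \<Rightarrow> int \<Rightarrow> (int \<Rightarrow> int) \<Rightarrow> int \<Rightarrow> int"
  where "insert_max n p \<tau> i =
    (if i < p then \<tau> i else if i = p then n else if i \<le> n then \<tau> (i - 1) else i)"

text \<open>The conjunct \<open>1 \<le> n\<close> of \<open>A\<close> is absent here: the empty
  permutation must count, since \<open>A_max\<close> at \<open>n = 1\<close> refers to length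
  \<open>0\<close>.\<close>

definition descent_count :: "int \<Rightarrow> int \<Rightarrow> int \<Rightarrow> int"
  where "descent_count r n m =
    int (card {\<sigma>. \<sigma> permutes {1..n} \<and> int (card (r_descents r n \<sigma>)) = m})"

lemma permutes_atLeastAtMost_bounds:
  fixes \<sigma> :: "int \<Rightarrow> int"
  assumes "\<sigma> permutes {1..n}" "1 \<le> i" "i \<le> n"
  shows "1 \<le> \<sigma> i" "\<sigma> i \<le> n"
  using permutes_in_image[OF assms(1), of i] assms(2,3) by auto

text \<open>Positions \<open>i \<le> 0\<close>, which \<open>\<tau>\<close> fixes, are included, so
  that shifted positions such as \<open>p - 1\<close> need no lower bound.\<close>

lemma permutes_less_max:
  fixes \<tau> :: "int \<Rightarrow> int"
  assumes "\<tau> permutes {1..n - 1}" "i < n"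
  shows "\<tau> i < n"
proof (cases "i \<in> {1..n - 1}")
  case True
  then show ?thesis using permutes_in_image[OF assms(1), of i] by auto
next
  case False
  then show ?thesis using permutes_not_in[OF assms(1)] assms(2) by auto
qed

lemma finite_r_descents [simp]: "finite (r_descents r n \<sigma>)"
  by (rule finite_subset[of _ "{1..n}"]) (auto simp: r_descents_def)

lemma insert_max_permutes:
  assumes \<tau>: "\<tau> permutes {1..n - 1}" and p: "1 \<le> p" "p \<le> n"
  shows "insert_max n p \<tau> permutes {1..n}"
proof -
  have lt: "\<tau> i < n" if "i < n" for i
    using permutes_less_max[OF \<tau>] that .
  have inj: "\<tau> i = \<tau> j \<longleftrightarrow> i = j" for i j
    using permutes_inj[OF \<tau>] by (auto dest: injD)
  have "inj_on (insert_max n p \<tau>) {1..n}"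
  proof (rule inj_onI)
    fix i j
    assume ij: "i \<in> {1..n}" "j \<in> {1..n}" and eq: "insert_max n p \<tau> i = insert_max n p \<tau> j"
    show "i = j"
      using ij eq p lt[of i] lt[of j] lt[of "i - 1"] lt[of "j - 1"]
      by (auto simp: insert_max_def inj split: if_splits)
  qed
  moreover have "insert_max n p \<tau> ` {1..n} \<subseteq> {1..n}"
  proof (rule image_subsetI)
    fix i
    assume "i \<in> {1..n}"
    then show "insert_max n p \<tau> i \<in> {1..n}"
      using p permutes_atLeastAtMost_bounds[OF \<tau>, of i]
        permutes_atLeastAtMost_bounds[OF \<tau>, of "i - 1"]
      by (auto simp: insert_max_def)
  qed
  ultimately have "bij_betw (insert_max n p \<tau>) {1..n} {1..n}"
    by (simp add: bij_betw_def endo_inj_surj)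
  then show ?thesis
    using p by (rule_tac bij_imp_permutes)
      (auto simp: insert_max_def permutes_not_in[OF \<tau>])
qed

text \<open>Injectivity: the place of the value \<open>n\<close> gives \<open>p\<close>, and
  deleting it gives \<open>\<tau>\<close>. Surjectivity follows by counting, as (n - 1)! * n =
  n!.\<close>

lemma insert_max_bij_betw:
  assumes "1 \<le> n"
  shows "bij_betw (\<lambda>(\<tau>, p). insert_max n p \<tau>)
    ({\<tau>. \<tau> permutes {1..n - 1}} \<times> {1..n}) {\<sigma>. \<sigma> permutes {1..n}}"
proof -
  let ?f = "\<lambda>(\<tau>, p). insert_max n p \<tau>"
  let ?X = "{\<tau>. \<tau> permutes {1..n - 1}} \<times> {1..n}"
  have inj: "inj_on ?f ?X"
  proof (rule inj_onI, clarsimp)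
    fix \<tau> p \<tau>' p'
    assume *: "\<tau> permutes {1..n - 1}" "1 \<le> p" "p \<le> n"
      "\<tau>' permutes {1..n - 1}" "1 \<le> p'" "p' \<le> n"
      and eq: "insert_max n p \<tau> = insert_max n p' \<tau>'"
    have "insert_max n p' \<tau>' p = n"
      using fun_cong[OF eq, of p] by (simp add: insert_max_def)
    then have p: "p = p'"
      using permutes_less_max[OF *(4), of p] permutes_less_max[OF *(4), of "p - 1"] *
      by (auto simp: insert_max_def split: if_splits)
    \<comment> \<open>For \<open>i < n\<close>, the value \<open>\<tau> i\<close> is read off at
      position \<open>i\<close> if \<open>i < p\<close> and at \<open>i + 1\<close>
      otherwise.\<close>
    have "\<tau> i = \<tau>' i" for i
      using fun_cong[OF eq, of i] fun_cong[OF eq, of "i + 1"] *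
        permutes_not_in[OF *(1), of i] permutes_not_in[OF *(4), of i]
      by (auto simp: insert_max_def p split: if_splits)
    then show "\<tau> = \<tau>' \<and> p = p'"
      using p by auto
  qed
  have sub: "?f ` ?X \<subseteq> {\<sigma>. \<sigma> permutes {1..n}}"
    by (auto intro: insert_max_permutes)
  have fin: "finite {\<sigma>. \<sigma> permutes {1..n}}"
    by (simp add: finite_permutations)
  have "card (?f ` ?X) = fact (nat (n - 1)) * nat n"
    by (simp add: card_image[OF inj] card_cartesian_product card_permutations[OF refl])
  also have "\<dots> = fact (nat n)"
    using assms by (simp add: fact_reduce[of "nat n"] nat_diff_distrib mult.commute)
  also have "\<dots> = card {\<sigma>. \<sigma> permutes {1..n}}"
    by (simp add: card_permutations[OF refl])
  finally have "?f ` ?X = {\<sigma>. \<sigma> permutes {1..n}}"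
    by (rule card_subset_eq[OF fin sub])
  with inj show ?thesis
    by (simp add: bij_betw_def)
qed

section \<open>Descents under insertion\<close>

text \<open>As \<open>p < n\<close>, some entry follows the inserted \<open>n\<close>, and
  \<open>p\<close> becomes a descent iff \<open>\<tau> p \<le> n - r\<close>. A descent of
  \<open>\<tau>\<close> lost at \<open>p - 1\<close> is always made up for at \<open>p\<close>,
  because it forces \<open>\<tau> p\<close> below \<open>n - r\<close>.\<close>

lemma card_r_descents_insert_max:
  assumes \<tau>: "\<tau> permutes {1..n - 1}" and p: "1 \<le> p" "p < n" and r: "r > 0"
  shows "card (r_descents r n (insert_max n p \<tau>)) =
    card (r_descents r (n - 1) \<tau>) +
    (if \<tau> p \<le> n - r \<and> p - 1 \<notin> r_descents r (n - 1) \<tau> then 1 else 0)"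
proof -
  let ?D = "r_descents r (n - 1) \<tau>"
  \<comment> \<open>The place to which a descent \<open>i\<close> of \<open>\<tau>\<close> moves;
    \<open>p - 1\<close> is excepted, as its pair is broken up.\<close>
  let ?s = "\<lambda>i. if i < p then i else i + 1"
  have lt: "\<tau> i < n" if "i < n" for i
    using permutes_less_max[OF \<tau>] that .
  have iff: "i \<in> r_descents r n (insert_max n p \<tau>) \<longleftrightarrow>
      i \<in> ?s ` (?D - {p - 1}) \<or> i = p \<and> \<tau> p \<le> n - r" for i
  proof -
    consider "i < p - 1" | "i = p - 1" | "i = p" | "i > p" by linarith
    then show ?thesis
    proof cases
      case 1
      then show ?thesis using p by (auto simp: r_descents_def insert_max_def image_iff)
    next
      case 2
      then show ?thesis using p r lt[of i]
        by (auto simp: r_descents_def insert_max_def image_iff)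
    next
      case 3
      then show ?thesis using p by (auto simp: r_descents_def insert_max_def image_iff)
    next
      case 4
      have "i \<in> ?s ` (?D - {p - 1}) \<longleftrightarrow> i - 1 \<in> ?D"
      proof
        assume "i - 1 \<in> ?D"
        then show "i \<in> ?s ` (?D - {p - 1})"
          using 4 by (intro image_eqI[of _ _ "i - 1"]) auto
      qed (use 4 in \<open>auto split: if_splits\<close>)
      also have "\<dots> \<longleftrightarrow> i \<in> r_descents r n (insert_max n p \<tau>)"
        using 4 p by (auto simp: r_descents_def insert_max_def)
      finally show ?thesis using 4 by auto
    qed
  qed
  have eq: "r_descents r n (insert_max n p \<tau>) =
      ?s ` (?D - {p - 1}) \<union> (if \<tau> p \<le> n - r then {p} else {})"
    using iff by auto
  have inj: "inj_on ?s (?D - {p - 1})"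
    by (auto simp: inj_on_def)
  have "card (r_descents r n (insert_max n p \<tau>)) =
      card (?s ` (?D - {p - 1})) + card (if \<tau> p \<le> n - r then {p} else {})"
    unfolding eq by (rule card_Un_disjoint) (auto split: if_splits)
  then have "card (r_descents r n (insert_max n p \<tau>)) =
      card (?D - {p - 1}) + (if \<tau> p \<le> n - r then 1 else 0)"
    by (simp only: card_image[OF inj]) simp
  moreover have "\<tau> p \<le> n - r" if "p - 1 \<in> ?D"
    using that lt[of "p - 1"] p by (auto simp: r_descents_def)
  \<comment> \<open>Subtraction is truncated, so \<open>card ?D - 1 + 1\<close> gives back
    \<open>card ?D\<close> only for nonempty \<open>?D\<close>.\<close>
  moreover have "card ?D > 0" if "p - 1 \<in> ?D"
    using that by (auto simp: card_gt_0_iff)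
  ultimately show ?thesis
    by (auto simp: card_Diff_singleton_if)
qed

text \<open>Exactly \<open>n - r\<close> positions carry a value at most \<open>n - r\<close>. The
  successors of the descents are among them and are to be left out; distinct descents have distinct
  successors.\<close>

lemma card_descent_raising_positions:
  assumes \<tau>: "\<tau> permutes {1..n - 1}" and r: "r > 0" "r \<le> n"
  shows "int (card {p \<in> {1..<n}. \<tau> p \<le> n - r \<and> p - 1 \<notin> r_descents r (n - 1) \<tau>}) =
    n - r - int (card (r_descents r (n - 1) \<tau>))"
proof -
  let ?D = "r_descents r (n - 1) \<tau>"
  let ?L = "{p \<in> {1..<n}. \<tau> p \<le> n - r}"
  have "?L = {1..n - 1} \<inter> \<tau> -` {1..n - r}"
    using permutes_atLeastAtMost_bounds(1)[OF \<tau>] by auto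
  \<comment> \<open>By \<open>r > 0\<close>, \<open>{1..n - r}\<close> lies in
    \<open>{1..n - 1}\<close>, hence so does its preimage.\<close>
  also have "\<dots> = \<tau> -` {1..n - r}"
    using permutes_in_image[OF \<tau>] r by fastforce
  finally have "card ?L = card {1..n - r}"
    using card_vimage_inj[OF permutes_inj[OF \<tau>], of "{1..n - r}"] permutes_surj[OF \<tau>] by simp
  then have L: "int (card ?L) = n - r"
    using r by simp
  have sub: "(\<lambda>i. i + 1) ` ?D \<subseteq> ?L"
  proof (rule image_subsetI)
    fix i assume i: "i \<in> ?D"
    then show "i + 1 \<in> ?L"
      using permutes_less_max[OF \<tau>, of i] by (auto simp: r_descents_def)
  qed
  have "{p \<in> {1..<n}. \<tau> p \<le> n - r \<and> p - 1 \<notin> ?D} = ?L - (\<lambda>i. i + 1) ` ?D"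
    by (force simp: image_iff)
  then have "card {p \<in> {1..<n}. \<tau> p \<le> n - r \<and> p - 1 \<notin> ?D} = card ?L - card ((\<lambda>i. i + 1) ` ?D)"
    using sub by (simp add: card_Diff_subset)
  moreover have "card ((\<lambda>i. i + 1) ` ?D) = card ?D"
    by (simp add: card_image)
  moreover have "card ((\<lambda>i. i + 1) ` ?D) \<le> card ?L"
    by (rule card_mono[OF finite_subset[of _ "{1..<n}"] sub]) auto
  ultimately show ?thesis
    using L by simp
qed

text \<open>If \<open>\<tau>\<close> has d descents, the \<open>n - 1\<close> positions split into n
  - r - d that raise d by one and r - 1 + d that keep it. So only d = m and d = m - 1
  contribute.\<close>

lemma card_positions_with_descents:
  assumes \<tau>: "\<tau> permutes {1..n - 1}" and r: "r > 0" "r \<le> n"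
  shows "int (card {p \<in> {1..<n}. int (card (r_descents r n (insert_max n p \<tau>))) = m}) =
    (if int (card (r_descents r (n - 1) \<tau>)) = m then m + r - 1 else 0) +
    (if int (card (r_descents r (n - 1) \<tau>)) = m - 1 then n - r - m + 1 else 0)"
proof -
  let ?d = "int (card (r_descents r (n - 1) \<tau>))"
  let ?G = "{p \<in> {1..<n}. \<tau> p \<le> n - r \<and> p - 1 \<notin> r_descents r (n - 1) \<tau>}"
  have G: "int (card ?G) = n - r - ?d"
    by (rule card_descent_raising_positions[OF assms])
  have "int (card ({1..<n} - ?G)) = int (card {1..<n}) - int (card ?G)"
    by (subst card_Diff_subset[OF finite_subset[of _ "{1..<n}"]])
      (auto simp del: card_atLeastLessThan_int intro!: of_nat_diff card_mono)
  then have G': "int (card ({1..<n} - ?G)) = r - 1 + ?d"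
    using G r by simp
  have eq: "{p \<in> {1..<n}. int (card (r_descents r n (insert_max n p \<tau>))) = m} =
      (if ?d = m then {1..<n} - ?G else if ?d = m - 1 then ?G else {})"
    using r by (auto simp: card_r_descents_insert_max[OF \<tau>] split: if_splits)
  show ?thesis
    unfolding eq using G G' by auto
qed

text \<open>The preceding count summed over \<open>S\<close>. The set \<open>S\<close> is left free
  to serve both the permutations with a prescribed last value and all permutations.\<close>

lemma card_insertions_with_descents:
  assumes S: "S \<subseteq> {\<tau>. \<tau> permutes {1..n - 1}}" and r: "r > 0" "r \<le> n"
  shows "int (card {\<sigma> \<in> (\<lambda>(\<tau>, p). insert_max n p \<tau>) ` (S \<times> {1..<n}).
      int (card (r_descents r n \<sigma>)) = m}) =
    (m + r - 1) * int (card {\<tau> \<in> S. int (card (r_descents r (n - 1) \<tau>)) = m}) +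
    (n - r - m + 1) * int (card {\<tau> \<in> S. int (card (r_descents r (n - 1) \<tau>)) = m - 1})"
    (is "int (card ?R) = ?rhs")
proof -
  let ?f = "\<lambda>(\<tau>, p). insert_max n p \<tau>"
  let ?X = "Sigma S (\<lambda>\<tau>. {p \<in> {1..<n}. int (card (r_descents r n (insert_max n p \<tau>))) = m})"
  have fin: "finite S"
    using finite_subset[OF S] by (simp add: finite_permutations)
  have "?R = ?f ` ?X" by auto
  moreover have "inj_on ?f ?X"
    using S r by (auto intro!: inj_on_subset[OF bij_betw_imp_inj_on[OF insert_max_bij_betw]])
  ultimately have "card ?R = card ?X"
    by (simp add: card_image)
  then have "int (card ?R) = (\<Sum>\<tau>\<in>S. int (card
      {p \<in> {1..<n}. int (card (r_descents r n (insert_max n p \<tau>))) = m}))"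
    using fin by (subst (asm) card_SigmaI) (auto intro: finite_subset[of _ "{1..<n}"])
  also have "\<dots> = (\<Sum>\<tau>\<in>S.
      (if int (card (r_descents r (n - 1) \<tau>)) = m then m + r - 1 else 0) +
      (if int (card (r_descents r (n - 1) \<tau>)) = m - 1 then n - r - m + 1 else 0))"
    using S r by (intro sum.cong refl card_positions_with_descents) auto
  also have "\<dots> = ?rhs"
    using fin by (simp add: sum.distrib sum.inter_filter[symmetric])
  finally show ?thesis .
qed

section \<open>Recurrences in \<open>n\<close>\<close>

lemma permutes_fixing_max:
  fixes n :: int
  assumes "1 \<le> n"
  shows "\<sigma> permutes {1..n} \<and> \<sigma> n = n \<longleftrightarrow> \<sigma> permutes {1..n - 1}"
proof
  assume "\<sigma> permutes {1..n} \<and> \<sigma> n = n"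
  then show "\<sigma> permutes {1..n - 1}"
    by (auto intro!: permutes_superset[of \<sigma> "{1..n}"] simp: order_le_less)
next
  assume "\<sigma> permutes {1..n - 1}"
  then show "\<sigma> permutes {1..n} \<and> \<sigma> n = n"
    by (auto intro: permutes_subset permutes_not_in)
qed

lemma r_descents_fixing_max:
  assumes "\<sigma> permutes {1..n - 1}" "r > 0"
  shows "r_descents r n \<sigma> = r_descents r (n - 1) \<sigma>"
proof -
  have "\<not> \<sigma> (n - 1) \<ge> \<sigma> n + r"
    using permutes_less_max[OF assms(1), of "n - 1"] permutes_not_in[OF assms(1), of n] assms(2)
    by auto
  then have "i < n - 1" if "i \<in> r_descents r n \<sigma>" for i
    using that by (cases "i = n - 1") (auto simp: r_descents_def)
  then show ?thesis
    by (auto simp: r_descents_def)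
qed

text \<open>Because permutations are extended by the identity, dropping a final \<open>n\<close>
  leaves the function itself unchanged, and position \<open>n - 1\<close> is never a
  descent.\<close>

lemma A_max:
  assumes "1 \<le> n" "r > 0"
  shows "A r n m n = descent_count r (n - 1) m"
proof -
  have "{\<sigma>. \<sigma> permutes {1..n} \<and> 1 \<le> n \<and> int (card (r_descents r n \<sigma>)) = m \<and> \<sigma> n = n} =
      {\<sigma>. (\<sigma> permutes {1..n} \<and> \<sigma> n = n) \<and> int (card (r_descents r n \<sigma>)) = m}"
    using assms by auto
  also have "\<dots> = {\<sigma>. \<sigma> permutes {1..n - 1} \<and> int (card (r_descents r (n - 1) \<sigma>)) = m}"
    unfolding permutes_fixing_max[OF assms(1)]
    by (rule Collect_cong) (metis r_descents_fixing_max[OF _ assms(2)])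
  finally have "{\<sigma>. \<sigma> permutes {1..n} \<and> 1 \<le> n \<and> int (card (r_descents r n \<sigma>)) = m \<and> \<sigma> n = n} =
      {\<sigma>. \<sigma> permutes {1..n - 1} \<and> int (card (r_descents r (n - 1) \<sigma>)) = m}" .
  then show ?thesis
    by (simp add: A_def descent_count_def)
qed

text \<open>As \<open>k < n\<close>, the value \<open>n\<close> does not stand last, so it was
  inserted at some \<open>p < n\<close>, and the last entry of \<open>\<tau>\<close> stays
  last.\<close>

lemma A_rec:
  assumes "r > 0" "r \<le> n" "1 \<le> k" "k < n"
  shows "A r n m k = (m + r - 1) * A r (n - 1) m k + (n - r - m + 1) * A r (n - 1) (m - 1) k"
proof -
  let ?S = "{\<tau>. \<tau> permutes {1..n - 1} \<and> \<tau> (n - 1) = k}"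
  let ?f = "\<lambda>(\<tau>, p). insert_max n p \<tau>"
  have iff: "\<sigma> permutes {1..n} \<and> \<sigma> n = k \<longleftrightarrow> \<sigma> \<in> ?f ` (?S \<times> {1..<n})" for \<sigma>
  proof
    assume \<sigma>: "\<sigma> permutes {1..n} \<and> \<sigma> n = k"
    then have "\<sigma> \<in> ?f ` ({\<tau>. \<tau> permutes {1..n - 1}} \<times> {1..n})"
      using bij_betw_imp_surj_on[OF insert_max_bij_betw, of n] assms by simp
    then obtain \<tau> p where *: "\<tau> permutes {1..n - 1}" "1 \<le> p" "p \<le> n" "\<sigma> = insert_max n p \<tau>"
      by auto
    have "p \<noteq> n"
      using * \<sigma> assms by (auto simp: insert_max_def)
    then have "p < n" "\<tau> (n - 1) = k"
      using * \<sigma> by (auto simp: insert_max_def)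
    then show "\<sigma> \<in> ?f ` (?S \<times> {1..<n})"
      using * by (intro image_eqI[of _ _ "(\<tau>, p)"]) auto
  next
    assume "\<sigma> \<in> ?f ` (?S \<times> {1..<n})"
    then obtain \<tau> p where *: "\<tau> permutes {1..n - 1}" "\<tau> (n - 1) = k"
        "1 \<le> p" "p < n" "\<sigma> = insert_max n p \<tau>"
      by auto
    then show "\<sigma> permutes {1..n} \<and> \<sigma> n = k"
      using insert_max_permutes[of \<tau> n p] by (auto simp: insert_max_def)
  qed
  have "A r n m k =
      int (card {\<sigma>. (\<sigma> permutes {1..n} \<and> \<sigma> n = k) \<and> int (card (r_descents r n \<sigma>)) = m})"
    unfolding A_def using assms by (intro arg_cong[of _ _ "\<lambda>X. int (card X)"]) auto
  also have "\<dots> = int (card {\<sigma> \<in> ?f ` (?S \<times> {1..<n}). int (card (r_descents r n \<sigma>)) = m})"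
    unfolding iff ..
  also have "\<dots> = (m + r - 1) * int (card {\<tau> \<in> ?S. int (card (r_descents r (n - 1) \<tau>)) = m}) +
      (n - r - m + 1) * int (card {\<tau> \<in> ?S. int (card (r_descents r (n - 1) \<tau>)) = m - 1})"
    using assms by (intro card_insertions_with_descents) auto
  finally have "A r n m k = \<dots>" .
  \<comment> \<open>From \<open>1 \<le> k\<close> and \<open>k < n\<close> comes
    \<open>1 \<le> n - 1\<close>, the extra conjunct in \<open>A r (n - 1) j k\<close>.\<close>
  moreover have "int (card {\<tau> \<in> ?S. int (card (r_descents r (n - 1) \<tau>)) = j}) = A r (n - 1) j k" for j
    unfolding A_def using assms by (intro arg_cong[of _ _ "\<lambda>X. int (card X)"]) auto
  ultimately show ?thesis by (simp only:)
qed

text \<open>Insertion at the end, \<open>p = n\<close>, now occurs too. It keeps the number of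
  descents and so raises the first coefficient from \<open>m + r - 1\<close> to
  \<open>m + r\<close>.\<close>

lemma descent_count_rec:
  assumes "r > 0" "r \<le> n"
  shows "descent_count r n m =
    (m + r) * descent_count r (n - 1) m + (n - r - m + 1) * descent_count r (n - 1) (m - 1)"
proof -
  let ?P = "{\<tau>. \<tau> permutes {1..n - 1}}"
  let ?f = "\<lambda>(\<tau>, p). insert_max n p \<tau>"
  let ?I = "{\<sigma> \<in> ?f ` (?P \<times> {1..<n}). int (card (r_descents r n \<sigma>)) = m}"
  let ?F = "{\<sigma> \<in> ?P. int (card (r_descents r (n - 1) \<sigma>)) = m}"
  have n: "1 \<le> n" using assms by linarith
  have "insert_max n n \<tau> = \<tau>" if "\<tau> permutes {1..n - 1}" for \<tau>
    using that by (auto simp: insert_max_def fun_eq_iff permutes_not_in)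
  then have "?f ` (?P \<times> {n}) = ?P"
    by (force simp: image_iff)
  moreover have "{1..n} = {1..<n} \<union> {n}"
    using n by auto
  then have "?f ` (?P \<times> {1..n}) = ?f ` (?P \<times> {1..<n}) \<union> ?f ` (?P \<times> {n})"
    by (simp only: Sigma_Un_distrib2 image_Un)
  ultimately have perms: "{\<sigma>. \<sigma> permutes {1..n}} = ?f ` (?P \<times> {1..<n}) \<union> ?P"
    using bij_betw_imp_surj_on[OF insert_max_bij_betw[OF n]] by simp
  \<comment> \<open>The last value separates the two families: it is \<open>n\<close> only for
    insertion at the end.\<close>
  have disj: "?f ` (?P \<times> {1..<n}) \<inter> ?P = {}"
  proof -
    have "insert_max n p \<tau> n < n" if "\<tau> permutes {1..n - 1}" "p < n" for \<tau> p
      using that permutes_less_max[OF that(1), of "n - 1"] by (auto simp: insert_max_def)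
    moreover have "\<sigma> n = n" if "\<sigma> permutes {1..n - 1}" for \<sigma>
      using that permutes_fixing_max[OF n] by blast
    ultimately show ?thesis by fastforce
  qed
  have F: "?F = {\<sigma> \<in> ?P. int (card (r_descents r n \<sigma>)) = m}"
    unfolding mem_Collect_eq by (rule Collect_cong) (metis r_descents_fixing_max[OF _ assms(1)])
  have "{\<sigma>. \<sigma> permutes {1..n} \<and> int (card (r_descents r n \<sigma>)) = m} =
      {\<sigma> \<in> {\<sigma>. \<sigma> permutes {1..n}}. int (card (r_descents r n \<sigma>)) = m}"
    by simp
  also have "\<dots> = ?I \<union> ?F"
    unfolding perms F by blast
  finally have "{\<sigma>. \<sigma> permutes {1..n} \<and> int (card (r_descents r n \<sigma>)) = m} = ?I \<union> ?F" .
  moreover have "card (?I \<union> ?F) = card ?I + card ?F"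
    using disj by (intro card_Un_disjoint) (auto simp: finite_permutations)
  ultimately have "descent_count r n m = int (card ?I) + descent_count r (n - 1) m"
    by (simp add: descent_count_def)
  also have "int (card ?I) = (m + r - 1) * descent_count r (n - 1) m +
      (n - r - m + 1) * descent_count r (n - 1) (m - 1)"
    using card_insertions_with_descents[of ?P n r m] assms by (simp add: descent_count_def)
  finally show ?thesis
    by (simp add: algebra_simps)
qed

section \<open>Initial values for \<open>n \<le> r\<close>\<close>

text \<open>Two values in \<open>{1..n}\<close> differ by at most \<open>n - 1 < r\<close>.\<close>

lemma r_descents_empty:
  assumes "\<sigma> permutes {1..n}" "n \<le> r"
  shows "r_descents r n \<sigma> = {}"
proof -
  have False if "i \<in> r_descents r n \<sigma>" for i
    using that permutes_atLeastAtMost_bounds[OF assms(1), of i]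
      permutes_atLeastAtMost_bounds[OF assms(1), of "i + 1"] assms(2)
    by (auto simp: r_descents_def)
  then show ?thesis by auto
qed

lemma descent_count_small:
  assumes "n \<le> r"
  shows "descent_count r n m = (if m = 0 then fact (nat n) else 0)"
proof -
  have "{\<sigma>. \<sigma> permutes {1..n} \<and> int (card (r_descents r n \<sigma>)) = m} =
      (if m = 0 then {\<sigma>. \<sigma> permutes {1..n}} else {})"
    using r_descents_empty[OF _ assms] by auto
  then show ?thesis
    by (simp add: descent_count_def card_permutations[OF refl])
qed

text \<open>Swapping the values \<open>k\<close> and \<open>n\<close> matches the permutations
  ending in \<open>k\<close> with the (n - 1)! ending in \<open>n\<close>; none of them has an
  \<open>r\<close>-descent.\<close>

lemma A_small:
  assumes "n \<le> r" "1 \<le> k" "k \<le> n"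
  shows "A r n m k = (if m = 0 then fact (nat (n - 1)) else 0)"
proof -
  have "bij_betw (\<lambda>\<sigma>. transpose k n \<circ> \<sigma>) {\<sigma>. \<sigma> permutes {1..n} \<and> \<sigma> n = n}
      {\<sigma>. \<sigma> permutes {1..n} \<and> \<sigma> n = k}"
    by (rule bij_betw_byWitness[of _ "\<lambda>\<sigma>. transpose k n \<circ> \<sigma>"])
      (use assms in \<open>auto simp: comp_assoc[symmetric] intro!: permutes_compose permutes_swap_id\<close>)
  then have "card {\<sigma>. \<sigma> permutes {1..n} \<and> \<sigma> n = k} = card {\<sigma>. \<sigma> permutes {1..n} \<and> \<sigma> n = n}"
    by (simp add: bij_betw_same_card)
  also have "\<dots> = fact (nat (n - 1))"
    using assms by (simp add: permutes_fixing_max card_permutations[OF refl])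
  finally have "card {\<sigma>. \<sigma> permutes {1..n} \<and> \<sigma> n = k} = fact (nat (n - 1))" .
  moreover have "{\<sigma>. \<sigma> permutes {1..n} \<and> 1 \<le> n \<and> int (card (r_descents r n \<sigma>)) = m \<and> \<sigma> n = k} =
      (if m = 0 then {\<sigma>. \<sigma> permutes {1..n} \<and> \<sigma> n = k} else {})"
    using r_descents_empty[OF _ assms(1)] assms by auto
  ultimately show ?thesis
    by (simp add: A_def)
qed

lemma A_eq_0:
  assumes "n < k"
  shows "A r n m k = 0"
proof -
  have "{\<sigma>. \<sigma> permutes {1..n} \<and> 1 \<le> n \<and> int (card (r_descents r n \<sigma>)) = m \<and> \<sigma> n = k} = {}"
    using permutes_atLeastAtMost_bounds(2)[of _ n n] assms by fastforce
  then show ?thesis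
    unfolding A_def by (simp only: card.empty of_nat_0)
qed

section \<open>Passage from \<open>r\<close> to \<open>r + 1\<close>\<close>

lemma fact_nat_reduce:
  fixes n :: int
  assumes "1 \<le> n"
  shows "(fact (nat n) :: int) = n * fact (nat (n - 1))"
  using assms by (simp add: fact_reduce[of "nat n"] nat_diff_distrib)

text \<open>What the claim for length \<open>n + 1\<close> amounts to when the last value is the
  maximum, \<open>k = n + 1\<close>.\<close>

lemma descent_count_Suc_r:
  assumes r: "r > 0" and "r \<le> n"
  shows "descent_count (r + 1) n m =
    (m + 1) * descent_count r (n - 1) (m + 1) + (n - m) * descent_count r (n - 1) m"
  using assms(2)
proof (induction n arbitrary: m rule: int_ge_induct)
  \<comment> \<open>At \<open>m = 0\<close> this is r! = r * (r - 1)!; at \<open>m = -1\<close> the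
    factor \<open>m + 1\<close> removes the only nonzero count.\<close>
  case base
  then show ?case
    using r by (simp add: descent_count_small fact_nat_reduce)
next
  case (step n)
  have 1: "descent_count (r + 1) (n + 1) m =
      (m + r + 1) * descent_count (r + 1) n m + (n - r - m + 1) * descent_count (r + 1) n (m - 1)"
    using descent_count_rec[of "r + 1" "n + 1" m] r step.hyps by (simp add: algebra_simps)
  have 2: "descent_count r n j =
      (j + r) * descent_count r (n - 1) j + (n - r - j + 1) * descent_count r (n - 1) (j - 1)" for j
    using descent_count_rec r step.hyps by simp
  \<comment> \<open>Both sides become the same combination of \<open>descent_count r (n - 1)\<close>
    at \<open>m + 1\<close>, \<open>m\<close> and \<open>m - 1\<close>.\<close>
  show ?case
    unfolding 1 step.IH by (simp add: 2 algebra_simps)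
qed

text \<open>Induction from \<open>n = r\<close>. Each step brings in the new last value
  \<open>k = n + 1\<close>, which the induction hypothesis does not cover;
  \<open>descent_count_Suc_r\<close> settles it.\<close>

lemma A_Suc_r:
  assumes r: "r > 0" and "r \<le> n" "2 \<le> k" "k \<le> n"
  shows "A (r + 1) n m k =
    A r n (m + 1) (k - 1) + (r - 1) * (A r (n - 1) m (k - 1) - A r (n - 1) (m + 1) (k - 1))"
  using assms(2-)
proof (induction n arbitrary: m rule: int_ge_induct)
  \<comment> \<open>At \<open>m = -1\<close> the terms (r - 1)! and (r - 1) * (r - 2)! cancel; at
    \<open>m = 0\<close> the latter alone remains. Here \<open>2 \<le> k \<le> r\<close> ensures
    \<open>r - 1 \<ge> 1\<close>.\<close>
  case base
  then show ?case
    using fact_nat_reduce[of "r - 1"] by (simp add: A_small)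
next
  case (step n)
  have rec: "A r (n + 1) (m + 1) (k - 1) =
      (m + r) * A r n (m + 1) (k - 1) + (n - r - m + 1) * A r n m (k - 1)"
    using A_rec[of r "n + 1" "k - 1" "m + 1"] r step by (simp add: algebra_simps)
  show ?case
  proof (cases "k = n + 1")
    case True
    have "A (r + 1) (n + 1) m k = descent_count (r + 1) n m"
      using A_max[of "n + 1" "r + 1" m] True r step by simp
    \<comment> \<open>Since \<open>k - 1 = n\<close>, \<open>A_max\<close> at length
      \<open>n\<close> turns the counts back into values of \<open>A\<close>.\<close>
    also have "\<dots> = (m + 1) * A r n (m + 1) (k - 1) + (n - m) * A r n m (k - 1)"
      using descent_count_Suc_r[OF r step.hyps] A_max[of n r] r step.hyps True by simp
    finally show ?thesis
      unfolding rec by (simp add: algebra_simps)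
  next
    case False
    have 1: "A (r + 1) (n + 1) m k = (m + r) * A (r + 1) n m k + (n - r - m + 1) * A (r + 1) n (m - 1) k"
      using A_rec[of "r + 1" "n + 1" k m] r step False by (simp add: algebra_simps)
    have 2: "A r n j (k - 1) =
        (j + r - 1) * A r (n - 1) j (k - 1) + (n - r - j + 1) * A r (n - 1) (j - 1) (k - 1)" for j
      using A_rec[of r n "k - 1" j] r step False by simp
    have IH: "A (r + 1) n j k =
        A r n (j + 1) (k - 1) + (r - 1) * (A r (n - 1) j (k - 1) - A r (n - 1) (j + 1) (k - 1))" for j
      using step False by simp
    \<comment> \<open>As \<open>k \<le> n\<close>, every term reduces to
      \<open>A r (n - 1) j (k - 1)\<close> with \<open>j\<close> among \<open>m + 1\<close>,
      \<open>m\<close>, \<open>m - 1\<close>, and the coefficients agree.\<close>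
    show ?thesis
      unfolding 1 IH rec by (simp add: 2 algebra_simps)
  qed
qed

text \<open>The last two assumptions exclude failures. For \<open>k = n + 1\<close> and
  \<open>m = -1\<close> the left side is 0, while \<open>A r n 0 n\<close> is positive. For
  \<open>2 \<le> k \<le> n < r\<close> and \<open>m = 0\<close> the left side is (n - 1)!, the right
  side (r - 1) * (n - 2)!.\<close>

theorem theorem8:
  fixes r n m k :: int
  assumes "r > 0"
    and "k \<ge> 2"
    and "k \<noteq> n + 1"
    and "k \<le> n \<longrightarrow> r \<le> n"
  shows "A (r + 1) n m k =
    A r n (m + 1) (k - 1) + (r - 1) * (A r (n - 1) m (k - 1) - A r (n - 1) (m + 1) (k - 1))"
proof (cases "k \<le> n")
  case True
  then show ?thesis using A_Suc_r assms by blast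
next
  case False
  \<comment> \<open>Now \<open>k - 1 > n\<close>, so in every term the last value exceeds the
    length.\<close>
  then show ?thesis using assms(3) by (simp add: A_eq_0)
qed

end
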